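(* For every formally self-adjoint $Q\in\mathrm{Diff}^1(\mathbb{R})$ and every $N\in\mathbb{N}$ there is a constant $C_N$ such that for all $\rho>1$ any non-trivial solution $u$ (not necessarily in $L^2(\mathbb{R})$) of $-u''+Qu=\rho^2u$ on $\mathbb{R}$ satisfies $$\limsup_{x\to\pm\infty}\frac{\ln|ED(u;x)|}{|x|}\le C_N\rho^{-N},\qquad\text{where } ED(u;x):=|u(x)|^2+\rho^{-2}|u'(x)|^2 .$$
   Context: $D=-i\partial_x$. $\mathrm{Diff}^1(\mathbb{R})$ is the space of differential operators $Qu=a_1(x)Du+a_0(x)u$ whose coefficients $a_0,a_1$ are smooth and bounded on $\mathbb{R}$ together with all their derivatives. $Q$ is formally self-adjoint if it is symmetric on $C_c^\infty(\mathbb{R})$ with respect to the $L^2(\mathbb{R})$ inner product. *)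

theory Defs
  imports "HOL-Analysis.Analysis"
begin

definition vderiv :: "(real \<Rightarrow> complex) \<Rightarrow> real \<Rightarrow> complex" where
  "vderiv f x = vector_derivative f (at x)"

definition smooth :: "(real \<Rightarrow> complex) \<Rightarrow> bool" where
  "smooth f \<longleftrightarrow> (\<forall>n x. (vderiv ^^ n) f differentiable at x)"

definition smooth_bounded :: "(real \<Rightarrow> complex) \<Rightarrow> bool" where
  "smooth_bounded f \<longleftrightarrow> smooth f \<and> (\<forall>n. bounded (range ((vderiv ^^ n) f)))"

definition test_function :: "(real \<Rightarrow> complex) \<Rightarrow> bool" where
  "test_function f \<longleftrightarrow> smooth f \<and> compact (closure {x. f x \<noteq> 0})"

definition D_op :: "(real \<Rightarrow> complex) \<Rightarrow> real \<Rightarrow> complex" where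
  "D_op u x = - \<i> * vderiv u x"

text \<open>Operators are total functions on \<open>real \<Rightarrow> complex\<close>; since \<^const>\<open>vector_derivative\<close> is
  unspecified where the derivative does not exist, they are only meaningful on differentiable
  functions.\<close>

definition Diff1 :: "((real \<Rightarrow> complex) \<Rightarrow> real \<Rightarrow> complex) set" where
  "Diff1 = {Q. \<exists>a1 a0. smooth_bounded a1 \<and> smooth_bounded a0 \<and>
                 Q = (\<lambda>u x. a1 x * D_op u x + a0 x * u x)}"

definition L2_inner :: "(real \<Rightarrow> complex) \<Rightarrow> (real \<Rightarrow> complex) \<Rightarrow> complex" where
  "L2_inner f g = (LINT x|lborel. f x * cnj (g x))"

definition formally_self_adjoint :: "((real \<Rightarrow> complex) \<Rightarrow> real \<Rightarrow> complex) \<Rightarrow> bool" where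
  "formally_self_adjoint Q \<longleftrightarrow>
     (\<forall>\<phi> \<psi>. test_function \<phi> \<longrightarrow> test_function \<psi> \<longrightarrow> L2_inner (Q \<phi>) \<psi> = L2_inner \<phi> (Q \<psi>))"

text \<open>Classical solutions of \<open>-u'' + Q u = \<rho>\<^sup>2 u\<close> on the whole line. Only twofold
  differentiability is demanded and nothing is assumed about growth or integrability; for
  smooth coefficients every such solution is smooth.\<close>

definition solution :: "((real \<Rightarrow> complex) \<Rightarrow> real \<Rightarrow> complex) \<Rightarrow> real \<Rightarrow> (real \<Rightarrow> complex) \<Rightarrow> bool" where
  "solution Q \<rho> u \<longleftrightarrow>
     (\<forall>x. u differentiable at x \<and> vderiv u differentiable at x \<and>
          - vderiv (vderiv u) x + Q u x = complex_of_real (\<rho>\<^sup>2) * u x)"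

definition ED :: "real \<Rightarrow> (real \<Rightarrow> complex) \<Rightarrow> real \<Rightarrow> real" where
  "ED \<rho> u x = (cmod (u x))\<^sup>2 + \<rho> powi (-2) * (cmod (vderiv u x))\<^sup>2"

end

theory Submission
  imports Defs
begin

text \<open>
  Write \<open>e = \<rho>\<^sup>-\<^sup>2\<close>. Formal self-adjointness forces \<open>a1\<close> to be real and
  \<open>Im a0 = - a1' / 2\<close> (\<open>self_adjoint_coefficients\<close>, by testing against bump functions). With the
  covariant derivative \<open>y = u' + i (a1 / 2) u\<close> the equation becomes
  \<open>u' = y - i (a1 / 2) u\<close>, \<open>y' = - i (a1 / 2) y - q u\<close>, where \<open>q = \<rho>\<^sup>2 - V\<close> and
  \<open>V = Re a0 - a1\<^sup>2 / 4\<close> is real. In the quadratic quantities \<open>m = |u|\<^sup>2\<close>, \<open>c = Re (cnj u y)\<close>,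
  \<open>p = |y|\<^sup>2\<close> the gauge potential \<open>a1\<close> drops out, and what is left is the linear system
  \<open>m' = 2 c\<close>, \<open>c' = p - q m\<close>, \<open>p' = - 2 q c\<close> of products of solutions of \<open>w'' = - q w\<close>.

  For a real function \<open>S\<close> consider the energy
  \<open>W = e (S p - S' c + (S'' / 2 + q S) m)\<close> and the defect
  \<open>\<Phi> = S\<^sup>2 (1 - e V) + e (S S'' / 2 - S'\<^sup>2 / 4) - 1\<close>. Two identities hold:
  \<open>S W = e |S y - S' u / 2|\<^sup>2 + (1 + \<Phi>) m\<close> and \<open>S W' = \<Phi>' m\<close>. If \<open>\<Phi> = 0\<close>, then \<open>S\<close> is a product of
  two solutions and \<open>W\<close> is conserved; if \<open>\<Phi>\<close> and \<open>\<Phi>'\<close> are small, then \<open>W\<close> is comparable to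
  \<open>m + e p\<close>, hence controls \<open>ED\<close>, and grows at an exponential rate \<open>O(\<Phi>')\<close> at most
  (\<open>refined_growth\<close>).

  It remains to find \<open>S\<close> with \<open>\<Phi> = O(e\<^sup>K)\<close>. If \<open>S = 1 + O(e)\<close> has defect \<open>e\<^sup>K R\<close>, then
  \<open>S - e\<^sup>K R / 2\<close> has defect \<open>O(e\<^sup>K\<^sup>+\<^sup>1)\<close>, because the linearization of \<open>\<Phi>\<close> at \<open>S\<close> is
  \<open>2 + O(e)\<close> (\<open>approximate_product_solution\<close>). All functions that arise are polynomials in
  \<open>e\<close> and in derivatives of the coefficients, hence bounded uniformly in \<open>x\<close> and \<open>e \<le> 1\<close>. When
  \<open>e\<close> is not small, \<open>\<rho>\<close> ranges over a bounded set and a crude Gronwall estimate suffices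
  (\<open>crude_growth\<close>).
\<close>

section \<open>Differential algebras of functions\<close>

text \<open>
  The functions of \<open>(e, x)\<close> that are polynomials in the parameter \<open>e\<close> and in finitely many of the
  generators, which depend on \<open>x\<close> only. An inductive set gives closure under \<open>d/dx\<close> and uniform
  bounds by rule induction, without Leibniz formulas for higher derivatives.
\<close>

inductive_set param_algebra :: "(real \<Rightarrow> real) set \<Rightarrow> (real \<Rightarrow> real \<Rightarrow> real) set"
  for G :: "(real \<Rightarrow> real) set" where
  generator: "g \<in> G \<Longrightarrow> (\<lambda>e x. g x) \<in> param_algebra G"
| const: "(\<lambda>e x. c) \<in> param_algebra G"
| param: "(\<lambda>e x. e) \<in> param_algebra G"
| add: "f \<in> param_algebra G \<Longrightarrow> g \<in> param_algebra G \<Longrightarrow> (\<lambda>e x. f e x + g e x) \<in> param_algebra G"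
| mult: "f \<in> param_algebra G \<Longrightarrow> g \<in> param_algebra G \<Longrightarrow> (\<lambda>e x. f e x * g e x) \<in> param_algebra G"

lemma param_algebra_diff:
  assumes "f \<in> param_algebra G" "g \<in> param_algebra G"
  shows "(\<lambda>e x. f e x - g e x) \<in> param_algebra G"
proof -
  have "(\<lambda>e x. f e x + (-1) * g e x) \<in> param_algebra G"
    by (intro param_algebra.add param_algebra.mult param_algebra.const assms)
  then show ?thesis by simp
qed

lemma param_algebra_power:
  assumes "f \<in> param_algebra G"
  shows "(\<lambda>e x. f e x ^ n) \<in> param_algebra G"
proof (induction n)
  case 0
  show ?case using param_algebra.const[of 1 G] by simp
next
  case (Suc n)
  show ?case using param_algebra.mult[OF assms Suc] by simp
qed

lemmas param_algebra_intros =
  param_algebra_diff param_algebra_power param_algebra.add param_algebra.mult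
  param_algebra.param param_algebra.const

lemma param_algebra_deriv:
  assumes G: "\<And>g. g \<in> G \<Longrightarrow> \<exists>h\<in>param_algebra G. \<forall>e x. (g has_real_derivative h e x) (at x)"
    and "f \<in> param_algebra G"
  shows "\<exists>f'\<in>param_algebra G. \<forall>e x. (f e has_real_derivative f' e x) (at x)"
  using assms(2)
proof induction
  case (generator g)
  then show ?case using G by simp
next
  case (const c)
  show ?case by (intro bexI[of _ "\<lambda>e x. 0"] allI DERIV_const param_algebra.const)
next
  case param
  show ?case by (intro bexI[of _ "\<lambda>e x. 0"] allI DERIV_const param_algebra.const)
next
  case (add f g)
  then obtain f' g' where "f' \<in> param_algebra G" "g' \<in> param_algebra G"
    and d: "\<And>e x. (f e has_real_derivative f' e x) (at x)" "\<And>e x. (g e has_real_derivative g' e x) (at x)"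
    by blast
  then show ?case
    by (intro bexI[of _ "\<lambda>e x. f' e x + g' e x"] allI DERIV_add param_algebra.add) auto
next
  case (mult f g)
  then obtain f' g' where "f' \<in> param_algebra G" "g' \<in> param_algebra G"
    and d: "\<And>e x. (f e has_real_derivative f' e x) (at x)" "\<And>e x. (g e has_real_derivative g' e x) (at x)"
    by blast
  then show ?case using mult
    by (intro bexI[of _ "\<lambda>e x. f' e x * g e x + g' e x * f e x"] allI DERIV_mult
        param_algebra.add param_algebra.mult) auto
qed

lemma param_algebra_bounded:
  assumes G: "\<And>g. g \<in> G \<Longrightarrow> \<exists>B. \<forall>x. \<bar>g x\<bar> \<le> B"
    and "f \<in> param_algebra G"
  shows "\<exists>B. \<forall>e\<in>{0..1}. \<forall>x. \<bar>f e x\<bar> \<le> B"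
  using assms(2)
proof induction
  case (generator g)
  then show ?case using G by simp
next
  case (const c)
  show ?case by auto
next
  case param
  show ?case by (intro exI[of _ 1]) auto
next
  case (add f g)
  then obtain A B where "\<forall>e\<in>{0..1}. \<forall>x. \<bar>f e x\<bar> \<le> A" "\<forall>e\<in>{0..1}. \<forall>x. \<bar>g e x\<bar> \<le> B"
    by blast
  then have "\<forall>e\<in>{0..1}. \<forall>x. \<bar>f e x + g e x\<bar> \<le> A + B"
    by (meson abs_triangle_ineq add_mono order_trans)
  then show ?case by blast
next
  case (mult f g)
  then obtain A B where AB: "\<forall>e\<in>{0..1}. \<forall>x. \<bar>f e x\<bar> \<le> A" "\<forall>e\<in>{0..1}. \<forall>x. \<bar>g e x\<bar> \<le> B"
    by blast
  have "\<bar>f e x * g e x\<bar> \<le> A * B" if "e \<in> {0..1}" for e x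
  proof -
    have f: "\<bar>f e x\<bar> \<le> A" and g: "\<bar>g e x\<bar> \<le> B" using AB that by blast+
    show ?thesis unfolding abs_mult by (rule mult_mono[OF f g]) (use f in linarith, simp)
  qed
  then show ?case by blast
qed

lemma DERIV_continuous_on_all:
  fixes f :: "real \<Rightarrow> real"
  assumes "\<And>x. (f has_real_derivative f' x) (at x)"
  shows "continuous_on A f"
  by (intro continuous_at_imp_continuous_on ballI DERIV_isCont[OF assms])

text \<open>
  Smoothness asks for all iterated derivatives. It follows from membership in any set of functions
  that is closed under differentiation.
\<close>

lemma smooth_of_real_algebra:
  assumes S: "\<And>f. f \<in> S \<Longrightarrow> \<exists>g\<in>S. \<forall>x. (f has_real_derivative g x) (at x)"
    and "f \<in> S"
  shows "smooth (\<lambda>x. complex_of_real (f x))"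
proof -
  have "\<exists>g\<in>S. (vderiv ^^ n) (\<lambda>x. complex_of_real (f x)) = (\<lambda>x. complex_of_real (g x))" for n
  proof (induction n)
    case 0
    show ?case using \<open>f \<in> S\<close> by auto
  next
    case (Suc n)
    then obtain g where g: "g \<in> S"
      "(vderiv ^^ n) (\<lambda>x. complex_of_real (f x)) = (\<lambda>x. complex_of_real (g x))" by blast
    obtain h where h: "h \<in> S" "\<And>x. (g has_real_derivative h x) (at x)" using S g by blast
    have "vderiv (\<lambda>x. complex_of_real (g x)) = (\<lambda>x. complex_of_real (h x))"
      unfolding vderiv_def using vector_derivative_at[OF has_vector_derivative_of_real[OF h(2)]] by (rule ext)
    then show ?case using g h by auto
  qed
  moreover have "(\<lambda>x. complex_of_real (g x)) differentiable at x" if "g \<in> S" for g x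
    using S[OF that] differentiableI_vector[OF has_vector_derivative_of_real] by blast
  ultimately show ?thesis unfolding smooth_def by metis
qed

section \<open>Test functions and formal self-adjointness\<close>

text \<open>
  The exponent \<open>k\<close> makes the span of this family, unlike \<open>exp (- 1 / x)\<close> alone, closed under
  differentiation.
\<close>

definition flat_exp :: "nat \<Rightarrow> real \<Rightarrow> real" where
  "flat_exp k x = (if x > 0 then exp (- inverse x) * inverse x ^ k else 0)"

text \<open>
  With \<open>t = 1 / x\<close> the claim is \<open>exp (- t) * t ^ (k + 2) \<le> (k + 2)!\<close>, a single term of the exponential
  series. The quadratic bound gives differentiability at the origin, with derivative zero.
\<close>

lemma flat_exp_le_square: "\<bar>flat_exp k x\<bar> \<le> fact (k + 2) * x\<^sup>2"
proof (cases "x > 0")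
  case True
  define t where "t = inverse x"
  have t: "t > 0" using True t_def by simp
  have "exp (- t) * t ^ n \<le> fact n" for n
  proof -
    have "t ^ n / fact n \<le> exp t"
      using t sum_le_suminf[of "\<lambda>n. t ^ n /\<^sub>R fact n" "{n}"] summable_exp_generic[of t]
      by (simp add: exp_def divide_inverse mult.commute)
    then show ?thesis by (simp add: exp_minus field_simps)
  qed
  then have "exp (- t) * t ^ (k+2) \<le> fact (k+2)" .
  then have "exp (- t) * t ^ (k+2) * x\<^sup>2 \<le> fact (k+2) * x\<^sup>2"
    by (intro mult_right_mono) auto
  moreover have "t ^ (k+2) * x\<^sup>2 = t ^ k"
    using True by (simp add: t_def power_add field_simps power2_eq_square)
  ultimately have "exp (- t) * t ^ k \<le> fact (k+2) * x\<^sup>2"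
    by (metis mult.assoc)
  then show ?thesis using True t by (simp add: flat_exp_def t_def[symmetric])
next
  case False
  then show ?thesis by (simp add: flat_exp_def)
qed

lemma flat_exp_deriv:
  "(flat_exp k has_real_derivative flat_exp (k + 2) x - real k * flat_exp (k + 1) x) (at x)"
proof -
  consider "x > 0" | "x < 0" | "x = 0" by linarith
  then show ?thesis
  proof cases
    case 1
    have p: "((\<lambda>x. inverse x ^ k) has_real_derivative - real k * inverse x ^ (k + 1)) (at x)"
    proof (cases k)
      case (Suc j)
      show ?thesis unfolding Suc
        by (rule DERIV_cong[OF DERIV_power_Suc[OF DERIV_inverse]]) (use 1 in \<open>auto simp: algebra_simps\<close>)
    qed simp
    have q: "((\<lambda>x. exp (- inverse x)) has_real_derivative exp (- inverse x) * (inverse x)\<^sup>2) (at x)"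
      using 1 by (auto intro!: derivative_eq_intros simp: power2_eq_square)
    have "((\<lambda>x. exp (- inverse x) * inverse x ^ k) has_real_derivative
        flat_exp (k + 2) x - real k * flat_exp (k + 1) x) (at x)"
      by (rule DERIV_cong[OF DERIV_mult[OF q p]])
        (use 1 in \<open>simp add: flat_exp_def power2_eq_square algebra_simps\<close>)
    then show ?thesis
      by (rule has_field_derivative_transform_within_open[of _ _ _ "{0<..}"])
        (use 1 in \<open>auto simp: flat_exp_def\<close>)
  next
    case 2
    have "((\<lambda>x. 0) has_real_derivative flat_exp (k + 2) x - real k * flat_exp (k + 1) x) (at x)"
      using 2 by (simp add: flat_exp_def)
    then show ?thesis
      by (rule has_field_derivative_transform_within_open[of _ _ _ "{..<0}"])
        (use 2 in \<open>auto simp: flat_exp_def\<close>)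
  next
    case 3
    have "((\<lambda>h. flat_exp k h / h) \<longlongrightarrow> 0) (at 0)"
    proof (rule tendsto_0_le[where K = 1])
      show "((\<lambda>h. fact (k + 2) * h) \<longlongrightarrow> (0::real)) (at 0)"
        by (auto intro!: tendsto_eq_intros)
      show "\<forall>\<^sub>F h in at 0. norm (flat_exp k h / h) \<le> norm (fact (k + 2) * h) * 1"
      proof (rule eventually_at_filter[THEN iffD2], rule always_eventually, intro allI impI)
        fix h :: real assume "h \<noteq> 0"
        have "\<bar>flat_exp k h\<bar> / \<bar>h\<bar> \<le> fact (k + 2) * h\<^sup>2 / \<bar>h\<bar>"
          by (intro divide_right_mono flat_exp_le_square) simp
        also have "fact (k + 2) * h\<^sup>2 / \<bar>h\<bar> = fact (k + 2) * \<bar>h\<bar>"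
          using \<open>h \<noteq> 0\<close> by (cases "h > 0") (auto simp: power2_eq_square simp del: fact_Suc)
        finally show "norm (flat_exp k h / h) \<le> norm (fact (k + 2) * h) * 1"
          by (simp add: abs_mult del: fact_Suc)
      qed
    qed
    then show ?thesis using 3 by (simp add: DERIV_def flat_exp_def)
  qed
qed

definition bump :: "real \<Rightarrow> real \<Rightarrow> real \<Rightarrow> real" where
  "bump a b x = flat_exp 0 (x - a) * flat_exp 0 (b - x)"

lemma bump_pos: "a < x \<Longrightarrow> x < b \<Longrightarrow> bump a b x > 0"
  by (simp add: bump_def flat_exp_def)

lemma bump_zero: "x \<notin> {a<..<b} \<Longrightarrow> bump a b x = 0"
  by (auto simp: bump_def flat_exp_def)

text \<open>
  Generators of a differential algebra that contains the bump and its product with the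
  coordinate \<open>x\<close>; both serve as test functions.
\<close>

definition bump_gens :: "real \<Rightarrow> real \<Rightarrow> (real \<Rightarrow> real) set" where
  "bump_gens a b = {\<lambda>x. x} \<union> range (\<lambda>k x. flat_exp k (x - a)) \<union> range (\<lambda>k x. flat_exp k (b - x))"

lemma bump_gens_deriv:
  assumes "g \<in> bump_gens a b"
  shows "\<exists>h\<in>param_algebra (bump_gens a b). \<forall>e x. (g has_real_derivative h e x) (at x)"
proof -
  have L: "(\<lambda>e x. flat_exp k (x - a)) \<in> param_algebra (bump_gens a b)"
    and R: "(\<lambda>e x. flat_exp k (b - x)) \<in> param_algebra (bump_gens a b)" for k
    by (rule param_algebra.generator, auto simp: bump_gens_def)+
  consider "g = (\<lambda>x. x)" | k where "g = (\<lambda>x. flat_exp k (x - a))" | k where "g = (\<lambda>x. flat_exp k (b - x))"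
    using assms unfolding bump_gens_def by blast
  then show ?thesis
  proof cases
    case 1
    then show ?thesis by (intro bexI[of _ "\<lambda>e x. 1"] param_algebra.const) (auto intro!: derivative_eq_intros)
  next
    case (2 k)
    have "(\<lambda>e x. flat_exp (k + 2) (x - a) - real k * flat_exp (k + 1) (x - a)) \<in> param_algebra (bump_gens a b)"
      by (intro param_algebra_diff param_algebra.mult param_algebra.const L)
    moreover have "(g has_real_derivative flat_exp (k + 2) (x - a) - real k * flat_exp (k + 1) (x - a)) (at x)" for x
      unfolding 2 by (rule DERIV_chain2[OF flat_exp_deriv, THEN DERIV_cong]) (auto intro!: derivative_eq_intros)
    ultimately show ?thesis by (intro bexI) auto
  next
    case (3 k)
    have "(\<lambda>e x. (- 1) * (flat_exp (k + 2) (b - x) - real k * flat_exp (k + 1) (b - x))) \<in> param_algebra (bump_gens a b)"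
      by (intro param_algebra_diff param_algebra.mult param_algebra.const R)
    moreover have "(g has_real_derivative (- 1) * (flat_exp (k + 2) (b - x) - real k * flat_exp (k + 1) (b - x))) (at x)" for x
      unfolding 3 by (rule DERIV_chain2[OF flat_exp_deriv, THEN DERIV_cong]) (auto intro!: derivative_eq_intros)
    ultimately show ?thesis by (intro bexI) auto
  qed
qed

lemma bump_test_functions:
  shows "test_function (\<lambda>x. complex_of_real (bump a b x))"
    and "test_function (\<lambda>x. complex_of_real (x * bump a b x))"
    and "\<exists>b'. continuous_on UNIV b' \<and> (\<forall>x. (bump a b has_real_derivative b' x) (at x))"
proof -
  define A where "A = param_algebra (bump_gens a b)"
  have closed: "\<exists>g\<in>A. \<forall>e x. (f e has_real_derivative g e x) (at x)" if "f \<in> A" for f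
    using param_algebra_deriv[OF bump_gens_deriv] that unfolding A_def by blast
  \<comment> \<open>No parameter is needed here, so the algebra is evaluated at \<open>e = 0\<close>.\<close>
  define A0 where "A0 = (\<lambda>f. f (0::real)) ` A"
  have closed0: "\<exists>g\<in>A0. \<forall>x. (f has_real_derivative g x) (at x)" if f: "f \<in> A0" for f
  proof -
    obtain k where k: "k \<in> A" "f = k 0" using f unfolding A0_def by blast
    obtain g where g: "g \<in> A" "\<And>e x. (k e has_real_derivative g e x) (at x)" using closed[OF k(1)] by blast
    show ?thesis using g unfolding A0_def k(2) by (intro bexI[of _ "g 0"] imageI) auto
  qed
  have gens: "(\<lambda>e x. x) \<in> A" "(\<lambda>e x. flat_exp 0 (x - a)) \<in> A" "(\<lambda>e x. flat_exp 0 (b - x)) \<in> A"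
    unfolding A_def by (rule param_algebra.generator, auto simp: bump_gens_def)+
  then have m1: "(\<lambda>e x. bump a b x) \<in> A"
    unfolding A_def bump_def by (intro param_algebra.mult)
  then have m2: "(\<lambda>e x. x * bump a b x) \<in> A"
    using gens(1) unfolding A_def by (intro param_algebra.mult)
  have m: "bump a b \<in> A0" "(\<lambda>x. x * bump a b x) \<in> A0"
    unfolding A0_def by (rule image_eqI[OF _ m1], simp) (rule image_eqI[OF _ m2], simp)
  have supp: "x \<in> {a..b}" if "bump a b x \<noteq> 0" for x
    using bump_zero[of x a b] that by fastforce
  have compact: "compact (closure {x. f x \<noteq> 0})" if "{x. f x \<noteq> 0} \<subseteq> {a..b}" for f :: "real \<Rightarrow> complex"
    unfolding compact_closure by (rule bounded_subset[OF bounded_closed_interval that])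
  show "test_function (\<lambda>x. complex_of_real (bump a b x))"
    unfolding test_function_def
    by (intro conjI smooth_of_real_algebra[OF closed0 m(1)] compact) (use supp in auto)
  show "test_function (\<lambda>x. complex_of_real (x * bump a b x))"
    unfolding test_function_def
    by (intro conjI smooth_of_real_algebra[OF closed0 m(2)] compact) (use supp in auto)
  obtain b' where b': "b' \<in> A0" "\<And>x. (bump a b has_real_derivative b' x) (at x)"
    using closed0[OF m(1)] by blast
  obtain b'' where "\<And>x. (b' has_real_derivative b'' x) (at x)" using closed0[OF b'(1)] by blast
  then have "continuous_on UNIV b'" by (rule DERIV_continuous_on_all)
  then show "\<exists>b'. continuous_on UNIV b' \<and> (\<forall>x. (bump a b has_real_derivative b' x) (at x))"
    using b' by blast
qed

text \<open>
  Near a point where \<open>g\<close> does not vanish, \<open>g\<close> has a strict sign, and so has its integral against the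
  square of a bump supported there.
\<close>

lemma zero_if_orthogonal_to_bumps:
  fixes g :: "real \<Rightarrow> real"
  assumes g: "continuous_on UNIV g"
    and orth: "\<And>a b. a < b \<Longrightarrow> integral {a..b} (\<lambda>x. g x * (bump a b x)\<^sup>2) = 0"
  shows "g x = 0"
proof (rule ccontr)
  assume nz: "g x \<noteq> 0"
  define s where "s = sgn (g x)"
  have "continuous_on UNIV (\<lambda>y. s * g y)" by (intro continuous_intros g)
  then have "open ((\<lambda>y. s * g y) -` {0<..})" by (intro open_vimage) auto
  moreover have "x \<in> (\<lambda>y. s * g y) -` {0<..}" using nz by (simp add: s_def sgn_mult_self_eq sgn_real_def)
  ultimately obtain d where d: "d > 0" "cball x d \<subseteq> (\<lambda>y. s * g y) -` {0<..}"
    using open_contains_cball by blast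
  define a b where "a = x - d" and "b = x + d"
  have ab: "a < x" "x < b" "a < b" using d by (auto simp: a_def b_def)
  have pos: "s * g y > 0" if "y \<in> {a..b}" for y
    using d(2) that by (auto simp: a_def b_def cball_eq_atLeastAtMost)
  obtain b' where db: "\<And>x. (bump a b has_real_derivative b' x) (at x)"
    using bump_test_functions(3) by blast
  have cb: "continuous_on A (bump a b)" for A
    by (rule DERIV_continuous_on_all[OF db])
  let ?f = "\<lambda>y. s * g y * (bump a b y)\<^sup>2"
  have "integral {a..b} ?f = s * integral {a..b} (\<lambda>x. g x * (bump a b x)\<^sup>2)"
    by (simp add: mult.assoc)
  then have "integral {a..b} ?f = 0" using orth ab by simp
  moreover have "continuous_on {a..b} ?f"
    by (intro continuous_intros cb continuous_on_subset[OF g]) auto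
  moreover have "\<And>y. y \<in> {a..b} \<Longrightarrow> ?f y \<ge> 0" using pos by (simp add: less_imp_le)
  ultimately have "\<forall>y\<in>{a..b}. ?f y = 0"
    using integral_eq_0_iff[of a b ?f] ab by auto
  then have "?f x = 0" using ab by (rule_tac bspec[of "{a..b}"]) auto
  moreover have "?f x > 0" using pos[of x] bump_pos[of a x b] ab by (intro mult_pos_pos[of "s * g x"] zero_less_power) auto
  ultimately show False by linarith
qed

lemma lborel_integral_supported:
  fixes f :: "real \<Rightarrow> complex"
  assumes "continuous_on UNIV f" and "\<And>x. x \<notin> {a..b} \<Longrightarrow> f x = 0"
  shows "(LINT x|lborel. f x) = integral {a..b} f"
proof -
  have "set_integrable lborel {a..b} f"
    unfolding set_integrable_def
    by (intro borel_integrable_compact continuous_on_subset[OF assms(1)]) auto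
  moreover have "(\<lambda>x. indicator {a..b} x *\<^sub>R f x) = f" using assms(2) by (auto simp: indicator_def)
  ultimately show "(LINT x|lborel. f x) = integral {a..b} f"
    using set_borel_integral_eq_integral(2)[of "{a..b}" f]
    by (simp_all add: set_integrable_def set_lebesgue_integral_def)
qed

lemma vderiv_of_real:
  "(f has_real_derivative d) (at x) \<Longrightarrow> vderiv (\<lambda>x. complex_of_real (f x)) x = complex_of_real d"
  unfolding vderiv_def by (rule vector_derivative_at[OF has_vector_derivative_of_real])

lemma smooth_has_vector_derivative:
  assumes "smooth f"
  shows "((vderiv ^^ n) f has_vector_derivative (vderiv ^^ Suc n) f x) (at x)"
proof -
  have "(vderiv ^^ n) f differentiable at x" using assms smooth_def by blast
  then show ?thesis by (simp add: vderiv_def vector_derivative_works[symmetric])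
qed

lemma Re_Im_has_real_derivative:
  "(f has_vector_derivative d) (at x) \<Longrightarrow> ((\<lambda>x. Re (f x)) has_real_derivative Re d) (at x)"
  "(f has_vector_derivative d) (at x) \<Longrightarrow> ((\<lambda>x. Im (f x)) has_real_derivative Im d) (at x)"
  by (simp_all add: has_real_derivative_iff_has_vector_derivative
      bounded_linear.has_vector_derivative[OF bounded_linear_Re]
      bounded_linear.has_vector_derivative[OF bounded_linear_Im])

lemma smooth_continuous:
  assumes "smooth f" shows "continuous_on A ((vderiv ^^ n) f)"
  by (intro continuous_at_imp_continuous_on ballI
      has_vector_derivative_continuous[OF smooth_has_vector_derivative[OF assms]])

text \<open>
  Let \<open>f\<close> be a real bump. Symmetry for the pair \<open>f\<close>, \<open>f\<close> says
  \<open>\<integral> (2 Im a0 f\<^sup>2 - 2 Re a1 f f') = 0\<close>, and \<open>2 Re a1 f f' = (Re a1 f\<^sup>2)' - Re a1' f\<^sup>2\<close> turns this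
  into \<open>\<integral> (Re a1' + 2 Im a0) f\<^sup>2 = 0\<close>. For the pair \<open>f\<close>, \<open>x f\<close> the derivative of the factor
  \<open>x\<close> contributes the extra term \<open>- \<integral> i (cnj a1) f\<^sup>2\<close>, and the real part gives
  \<open>\<integral> Im a1 f\<^sup>2 = 0\<close>.
\<close>

lemma self_adjoint_coefficients:
  assumes s1: "smooth a1" and s0: "smooth a0"
    and sa: "formally_self_adjoint (\<lambda>u x. a1 x * D_op u x + a0 x * u x)"
  shows "Im (a1 x) = 0" and "Im (a0 x) = - Re (vderiv a1 x) / 2"
proof -
  have c1: "continuous_on A a1" and c1': "continuous_on A (vderiv a1)" and c0: "continuous_on A a0" for A
    using smooth_continuous[OF s1, of A 0] smooth_continuous[OF s1, of A 1] smooth_continuous[OF s0, of A 0]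
    by simp_all
  have key: "integral {a..b} (\<lambda>x. Im (a1 x) * (bump a b x)\<^sup>2) = 0 \<and>
      integral {a..b} (\<lambda>x. (Re (vderiv a1 x) + 2 * Im (a0 x)) * (bump a b x)\<^sup>2) = 0" if "a < b" for a b
  proof -
    define f where "f = bump a b"
    obtain f' where cf': "continuous_on UNIV f'" and df: "\<And>x. (f has_real_derivative f' x) (at x)"
      using bump_test_functions(3) f_def by blast
    have cf: "continuous_on A f" for A
      by (rule DERIV_continuous_on_all[OF df])
    have cf': "continuous_on A f'" for A by (rule continuous_on_subset[OF cf']) simp
    have f0: "f x = 0" if "x \<notin> {a<..<b}" for x using bump_zero that f_def by blast
    let ?Q = "\<lambda>u x. a1 x * D_op u x + a0 x * u x"
    let ?f = "\<lambda>x. complex_of_real (f x)"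
    let ?H = "\<lambda>x. complex_of_real (2 * Im (a0 x) * (f x)\<^sup>2 - 2 * Re (a1 x) * f x * f' x) * \<i>"
    \<comment> \<open>Symmetry of the operator for the pair of real test functions \<open>f\<close>, \<open>k\<close>, written out.\<close>
    have symm: "integral {a..b} (\<lambda>x. (- \<i> * a1 x * f' x + a0 x * f x) * k x
         - f x * (\<i> * cnj (a1 x) * k' x + cnj (a0 x) * k x)) = 0"
      if k: "test_function (\<lambda>x. complex_of_real (k x))" "\<And>x. (k has_real_derivative k' x) (at x)"
        "continuous_on UNIV k'" "\<And>x. x \<notin> {a..b} \<Longrightarrow> k x = 0" for k k'
    proof -
      have ck: "continuous_on UNIV k"
        by (rule DERIV_continuous_on_all[OF k(2)])
      let ?A = "\<lambda>x. (- \<i> * a1 x * f' x + a0 x * f x) * k x"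
      let ?B = "\<lambda>x. f x * (\<i> * cnj (a1 x) * k' x + cnj (a0 x) * k x)"
      have A: "L2_inner (?Q ?f) (\<lambda>x. complex_of_real (k x)) = (LINT x|lborel. ?A x)"
        unfolding L2_inner_def D_op_def vderiv_of_real[OF df] by (simp add: mult_ac)
      have B: "L2_inner ?f (?Q (\<lambda>x. complex_of_real (k x))) = (LINT x|lborel. ?B x)"
        unfolding L2_inner_def D_op_def vderiv_of_real[OF k(2)] by (simp add: ac_simps)
      have "L2_inner (?Q ?f) (\<lambda>x. complex_of_real (k x)) = L2_inner ?f (?Q (\<lambda>x. complex_of_real (k x)))"
        using sa k(1) bump_test_functions(1)[of a b] unfolding formally_self_adjoint_def f_def by blast
      then have eq: "(LINT x|lborel. ?A x) = (LINT x|lborel. ?B x)" using A B by simp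
      have cA: "continuous_on UNIV ?A" and cB: "continuous_on UNIV ?B"
        by (intro continuous_intros c1 c0 cf cf' ck k)+
      have zA: "?A x = 0" and zB: "?B x = 0" if "x \<notin> {a..b}" for x
        using that k(4) f0[of x] by auto
      have "integral {a..b} ?A = integral {a..b} ?B"
        using eq lborel_integral_supported[OF cA zA] lborel_integral_supported[OF cB zB] by simp
      moreover have "?A integrable_on {a..b}" "?B integrable_on {a..b}"
        using cA cB by (auto intro!: integrable_continuous_interval intro: continuous_on_subset)
      ultimately show ?thesis by (simp add: Henstock_Kurzweil_Integration.integral_diff)
    qed
    have "integral {a..b} (\<lambda>x. (- \<i> * a1 x * f' x + a0 x * f x) * f x
         - f x * (\<i> * cnj (a1 x) * f' x + cnj (a0 x) * f x)) = 0"
      by (rule symm) (use bump_test_functions(1) df cf' f0 in \<open>auto simp: f_def\<close>)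
    moreover have "(- \<i> * a1 x * f' x + a0 x * f x) * f x
         - f x * (\<i> * cnj (a1 x) * f' x + cnj (a0 x) * f x) = ?H x" for x
      by (simp add: complex_eq_iff power2_eq_square algebra_simps)
    ultimately have H0: "integral {a..b} ?H = 0" by simp
    have df2: "((\<lambda>x. x * f x) has_real_derivative x * f' x + f x) (at x)" for x
      by (auto intro!: derivative_eq_intros df)
    have "integral {a..b} (\<lambda>x. (- \<i> * a1 x * f' x + a0 x * f x) * complex_of_real (x * f x)
         - f x * (\<i> * cnj (a1 x) * complex_of_real (x * f' x + f x)
           + cnj (a0 x) * complex_of_real (x * f x))) = 0"
      by (rule symm[OF bump_test_functions(2)[of a b, folded f_def] df2])
        (auto intro!: continuous_intros cf cf' simp: f0)
    moreover have "(- \<i> * a1 x * f' x + a0 x * f x) * complex_of_real (x * f x)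
         - f x * (\<i> * cnj (a1 x) * complex_of_real (x * f' x + f x)
           + cnj (a0 x) * complex_of_real (x * f x)) =
       of_real x * ?H x - \<i> * cnj (a1 x) * (f x)\<^sup>2" for x
      by (simp add: complex_eq_iff power2_eq_square algebra_simps)
    ultimately have K0: "integral {a..b} (\<lambda>x. of_real x * ?H x - \<i> * cnj (a1 x) * (f x)\<^sup>2) = 0" (is "integral _ ?K = 0")
      by simp
    have "?K integrable_on {a..b}" 
      by (intro integrable_continuous_interval continuous_intros c1 c0 cf cf')
    then have "integral {a..b} (\<lambda>x. Re (?K x)) = 0"
      using integral_linear[OF _ bounded_linear_Re, of ?K "{a..b}"] K0 by (simp add: o_def)
    then have "integral {a..b} (\<lambda>x. - (Im (a1 x) * (f x)\<^sup>2)) = 0"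
      by (simp add: power2_eq_square)
    then have I1: "integral {a..b} (\<lambda>x. Im (a1 x) * (f x)\<^sup>2) = 0" by simp
    have "?H integrable_on {a..b}" 
      by (intro integrable_continuous_interval continuous_intros c1 c0 cf cf')
    then have H1: "integral {a..b} (\<lambda>x. 2 * Im (a0 x) * (f x)\<^sup>2 - 2 * Re (a1 x) * f x * f' x) = 0"
      (is "integral _ ?h = 0")
      using integral_linear[OF _ bounded_linear_Im, of ?H "{a..b}"] H0 by (simp add: o_def)
    let ?j = "\<lambda>x. Re (vderiv a1 x) * (f x)\<^sup>2 + 2 * Re (a1 x) * f x * f' x"
    have d1: "((\<lambda>x. Re (a1 x)) has_real_derivative Re (vderiv a1 x)) (at x)" for x
      by (rule Re_Im_has_real_derivative(1)) (use smooth_has_vector_derivative[OF s1, of 0 x] in simp)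
    have dj: "((\<lambda>x. Re (a1 x) * (f x)\<^sup>2) has_real_derivative ?j x) (at x)" for x
      by (rule DERIV_cong[OF DERIV_mult[OF d1 DERIV_power[OF df, of 2]]]) simp
    have "(?j has_integral (Re (a1 b) * (f b)\<^sup>2 - Re (a1 a) * (f a)\<^sup>2)) {a..b}"
      using fundamental_theorem_of_calculus[OF less_imp_le[OF \<open>a < b\<close>]
          has_vector_derivative_at_within[OF dj[unfolded has_real_derivative_iff_has_vector_derivative]]]
      by simp
    then have j: "(?j has_integral 0) {a..b}" using f0[of a] f0[of b] by simp
    have "?h integrable_on {a..b}"
      by (intro integrable_continuous_interval continuous_intros c1 c0 cf cf')
    then have "(?h has_integral 0) {a..b}" using H1 by (simp add: has_integral_integral)
    from has_integral_add[OF this j]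
    have "((\<lambda>x. (Re (vderiv a1 x) + 2 * Im (a0 x)) * (f x)\<^sup>2) has_integral 0) {a..b}"
      by (simp add: algebra_simps)
    then show ?thesis using I1 f_def by (simp add: integral_unique)
  qed
  show "Im (a1 x) = 0"
    by (rule zero_if_orthogonal_to_bumps) (use key in \<open>auto intro!: continuous_intros c1\<close>)
  have "Re (vderiv a1 x) + 2 * Im (a0 x) = 0"
    by (rule zero_if_orthogonal_to_bumps) (use key in \<open>auto intro!: continuous_intros c1' c0\<close>)
  then show "Im (a0 x) = - Re (vderiv a1 x) / 2" by simp
qed

section \<open>Approximate solutions of the product equation\<close>

text \<open>
  The correction \<open>t = - R / 2\<close> removes the leading defect: in the expansion of the defect of
  \<open>S + e\<^sup>K t\<close> the term linear in \<open>t\<close> is \<open>e\<^sup>K (2 S t + O(e)) = e\<^sup>K (- R + O(e))\<close>, because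
  \<open>S = 1 + e T\<close>, and the quadratic terms carry \<open>e\<^sup>2\<^sup>K\<close>. Working with the first integral instead of the
  third-order equation for \<open>S\<close> makes each step algebraic: no antiderivative has to be taken,
  and so no boundedness is lost.
\<close>

lemma approximate_product_solution:
  fixes \<G> :: "(real \<Rightarrow> real) set" and V :: "real \<Rightarrow> real" and A :: "(real \<Rightarrow> real \<Rightarrow> real) set"
  defines "A \<equiv> param_algebra \<G>"
  assumes closed: "\<And>f. f \<in> A \<Longrightarrow> \<exists>f'\<in>A. \<forall>e x. (f e has_real_derivative f' e x) (at x)"
    and V: "(\<lambda>e x. V x) \<in> A"
  shows "\<exists>S\<in>A. \<exists>S1\<in>A. \<exists>S2\<in>A. \<exists>T\<in>A. \<exists>R\<in>A.
     (\<forall>e x. (S e has_real_derivative S1 e x) (at x)) \<and>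
     (\<forall>e x. (S1 e has_real_derivative S2 e x) (at x)) \<and>
     (\<forall>e x. S e x = 1 + e * T e x) \<and>
     (\<forall>e x. (S e x)\<^sup>2 * (1 - e * V x) + e * (S e x * S2 e x / 2 - (S1 e x)\<^sup>2 / 4) - 1 = e ^ Suc k * R e x)"
proof (induction k)
  case 0
  have "(\<lambda>e x. 0) \<in> A" "(\<lambda>e x. 1) \<in> A" "(\<lambda>e x. (-1) * V x) \<in> A"
    using V unfolding A_def by (intro param_algebra.mult param_algebra.const)+
  then show ?case
    by (intro bexI[of _ "\<lambda>e x. 1"] bexI[of _ "\<lambda>e x. 0"] bexI[of _ "\<lambda>e x. (-1) * V x"]) auto
next
  case (Suc k)
  then obtain S S1 S2 T R where mem: "S \<in> A" "S1 \<in> A" "S2 \<in> A" "T \<in> A" "R \<in> A"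
    and d: "\<And>e x. (S e has_real_derivative S1 e x) (at x)" "\<And>e x. (S1 e has_real_derivative S2 e x) (at x)"
    and ST: "\<And>e x. S e x = 1 + e * T e x"
    and R: "\<And>e x. (S e x)\<^sup>2 * (1 - e * V x) + e * (S e x * S2 e x / 2 - (S1 e x)\<^sup>2 / 4) - 1
      = e ^ Suc k * R e x"
    by metis
  obtain R1 where R1: "R1 \<in> A" "\<And>e x. (R e has_real_derivative R1 e x) (at x)"
    using closed mem by blast
  obtain R2 where R2: "R2 \<in> A" "\<And>e x. (R1 e has_real_derivative R2 e x) (at x)"
    using closed R1 by blast
  define t t1 t2 where "t = (\<lambda>e x. (- 1 / 2) * R e x)" and "t1 = (\<lambda>e x. (- 1 / 2) * R1 e x)"
    and "t2 = (\<lambda>e x. (- 1 / 2) * R2 e x)"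
  have t: "t \<in> A" "t1 \<in> A" "t2 \<in> A"
    unfolding t_def t1_def t2_def A_def
    by (intro param_algebra.mult param_algebra.const mem[unfolded A_def]
        R1(1)[unfolded A_def] R2(1)[unfolded A_def])+
  have dt: "(t e has_real_derivative t1 e x) (at x)" "(t1 e has_real_derivative t2 e x) (at x)" for e x
    unfolding t_def t1_def t2_def by (intro DERIV_cmult R1 R2)+
  define S' S1' S2' T' R' where "S' = (\<lambda>e x. S e x + e ^ Suc k * t e x)"
    and "S1' = (\<lambda>e x. S1 e x + e ^ Suc k * t1 e x)"
    and "S2' = (\<lambda>e x. S2 e x + e ^ Suc k * t2 e x)"
    and "T' = (\<lambda>e x. T e x + e ^ k * t e x)"
    and "R' = (\<lambda>e x. 2 * t e x * (T e x - V x * S e x)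
         + (1 / 2) * (S e x * t2 e x + t e x * S2 e x - S1 e x * t1 e x)
         + e ^ k * (t e x ^ 2 * (1 - e * V x) + e * ((1 / 2) * (t e x * t2 e x) - (1 / 4) * t1 e x ^ 2)))"
  have mem': "S' \<in> A" "S1' \<in> A" "S2' \<in> A" "T' \<in> A" "R' \<in> A"
    unfolding S'_def S1'_def S2'_def T'_def R'_def A_def
    by (intro param_algebra_intros mem[unfolded A_def] t[unfolded A_def] V[unfolded A_def])+
  have d': "(S' e has_real_derivative S1' e x) (at x)" "(S1' e has_real_derivative S2' e x) (at x)" for e x
    unfolding S'_def S1'_def S2'_def by (intro DERIV_add DERIV_cmult d dt)+
  have ST': "S' e x = 1 + e * T' e x" for e x
    unfolding S'_def T'_def ST by (simp add: algebra_simps)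
  have R': "(S' e x)\<^sup>2 * (1 - e * V x) + e * (S' e x * S2' e x / 2 - (S1' e x)\<^sup>2 / 4) - 1
      = e ^ Suc (Suc k) * R' e x" for e x
  proof -
    define E where "E = e ^ k"
    have R_t: "R e x = - 2 * t e x" by (simp add: t_def)
    have *: "(S e x)\<^sup>2 * (1 - e * V x) + e * (S e x * S2 e x / 2 - (S1 e x)\<^sup>2 / 4) - 1
      = e * E * (- 2 * t e x)" using R[of e x] by (simp add: R_t E_def)
    have "(S' e x)\<^sup>2 * (1 - e * V x) + e * (S' e x * S2' e x / 2 - (S1' e x)\<^sup>2 / 4) - 1
      = ((S e x)\<^sup>2 * (1 - e * V x) + e * (S e x * S2 e x / 2 - (S1 e x)\<^sup>2 / 4) - 1)
       + e * E * (2 * t e x * (S e x - e * V x * S e x) + e * (S e x * t2 e x + t e x * S2 e x - S1 e x * t1 e x) / 2)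
       + (e * E)\<^sup>2 * (t e x ^ 2 * (1 - e * V x) + e * ((t e x * t2 e x) / 2 - t1 e x ^ 2 / 4))"
      unfolding S'_def S1'_def S2'_def by (simp add: E_def[symmetric]) (simp add: power2_eq_square field_simps)
    also have "\<dots> = e * (e * E) * R' e x"
      unfolding * R'_def by (simp add: E_def[symmetric]) (simp add: ST power2_eq_square field_simps)
    finally show ?thesis by (simp add: E_def)
  qed
  show ?case using mem' d' ST' R' by blast
qed

section \<open>Energy estimates\<close>

lemma gronwall_two_sided:
  fixes W :: "real \<Rightarrow> real"
  assumes d: "\<And>x. (W has_real_derivative W' x) (at x)" and b: "\<And>x. \<bar>W' x\<bar> \<le> \<delta> * W x"
  shows "W x \<le> W 0 * exp (\<delta> * \<bar>x\<bar>)"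
proof (cases "x \<ge> 0")
  case True
  have "W x * exp (- \<delta> * x) \<le> W 0 * exp (- \<delta> * 0)"
  proof (rule DERIV_nonpos_imp_nonincreasing[OF True])
    fix y
    have "((\<lambda>x. W x * exp (- \<delta> * x)) has_real_derivative (W' y - \<delta> * W y) * exp (- \<delta> * y)) (at y)"
      by (auto intro!: derivative_eq_intros d simp: algebra_simps)
    moreover have "(W' y - \<delta> * W y) * exp (- \<delta> * y) \<le> 0"
      using b[of y] by (intro mult_nonpos_nonneg) auto
    ultimately show "\<exists>z. ((\<lambda>x. W x * exp (- \<delta> * x)) has_real_derivative z) (at y) \<and> z \<le> 0" by blast
  qed
  then show ?thesis using True by (simp add: exp_minus field_simps)
next
  case False
  then have x: "x \<le> 0" by simp
  have "W x * exp (\<delta> * x) \<le> W 0 * exp (\<delta> * 0)"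
  proof (rule DERIV_nonneg_imp_nondecreasing[OF x])
    fix y
    have "((\<lambda>x. W x * exp (\<delta> * x)) has_real_derivative (W' y + \<delta> * W y) * exp (\<delta> * y)) (at y)"
      by (auto intro!: derivative_eq_intros d simp: algebra_simps)
    moreover have "(W' y + \<delta> * W y) * exp (\<delta> * y) \<ge> 0"
      using b[of y] by (intro mult_nonneg_nonneg) auto
    ultimately show "\<exists>z. ((\<lambda>x. W x * exp (\<delta> * x)) has_real_derivative z) (at y) \<and> 0 \<le> z" by blast
  qed
  then show ?thesis using x by (simp add: exp_minus field_simps)
qed

text \<open>
  The constant is enlarged to be at least \<open>1\<close>, so that the logarithmic bound also holds at zeros of
  \<open>f\<close>, where \<open>ln 0 = 0\<close>.
\<close>

lemma Limsup_log_growth_le: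
  fixes f :: "real \<Rightarrow> real"
  assumes f0: "\<And>x. 0 \<le> f x" and le: "\<And>x. f x \<le> M * exp (\<delta> * \<bar>x\<bar>)" and "\<delta> \<ge> 0" "\<delta> \<le> \<delta>'"
  shows "Limsup at_top (\<lambda>x. ereal (ln \<bar>f x\<bar> / \<bar>x\<bar>)) \<le> ereal \<delta>'"
    and "Limsup at_bot (\<lambda>x. ereal (ln \<bar>f x\<bar> / \<bar>x\<bar>)) \<le> ereal \<delta>'"
proof -
  define M' where "M' = max 1 M"
  have M': "M' \<ge> 1" "f x \<le> M' * exp (\<delta> * \<bar>x\<bar>)" for x
    using le[of x] by (auto simp: M'_def intro: order_trans mult_right_mono)
  have log: "ln \<bar>f x\<bar> \<le> ln M' + \<delta> * \<bar>x\<bar>" for x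
  proof (cases "f x = 0")
    case True
    then show ?thesis using M' \<open>\<delta> \<ge> 0\<close> by simp
  next
    case False
    then have "ln (f x) \<le> ln (M' * exp (\<delta> * \<bar>x\<bar>))"
      using M'(2)[of x] f0[of x] by (intro ln_mono) auto
    then show ?thesis using M'(1) f0[of x] by (simp add: ln_mult)
  qed
  have bound: "Limsup F (\<lambda>x. ereal (ln \<bar>f x\<bar> / \<bar>x\<bar>)) \<le> ereal \<delta>'"
    if F: "F \<noteq> bot" "filterlim (\<lambda>x. \<bar>x\<bar>) at_top F" for F :: "real filter"
  proof -
    have "\<forall>\<^sub>F x in F. \<bar>x\<bar> > 0" using F(2) unfolding filterlim_at_top_dense by blast
    then have "\<forall>\<^sub>F x in F. ereal (ln \<bar>f x\<bar> / \<bar>x\<bar>) \<le> ereal (ln M' / \<bar>x\<bar> + \<delta>)"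
      by eventually_elim (use log in \<open>simp add: field_simps\<close>)
    then have "Limsup F (\<lambda>x. ereal (ln \<bar>f x\<bar> / \<bar>x\<bar>)) \<le> Limsup F (\<lambda>x. ereal (ln M' / \<bar>x\<bar> + \<delta>))"
      by (rule Limsup_mono)
    also have "((\<lambda>x. ln M' / \<bar>x\<bar> + \<delta>) \<longlongrightarrow> 0 + \<delta>) F"
      by (intro tendsto_add tendsto_const real_tendsto_divide_at_top[OF tendsto_const F(2)])
    then have "Limsup F (\<lambda>x. ereal (ln M' / \<bar>x\<bar> + \<delta>)) = ereal \<delta>"
      using F(1) by (intro lim_imp_Limsup) auto
    finally show ?thesis using \<open>\<delta> \<le> \<delta>'\<close> by (meson ereal_less_eq(3) order_trans)
  qed
  show "Limsup at_top (\<lambda>x. ereal (ln \<bar>f x\<bar> / \<bar>x\<bar>)) \<le> ereal \<delta>'"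
    by (rule bound) (auto simp: filterlim_abs_real)
  show "Limsup at_bot (\<lambda>x. ereal (ln \<bar>f x\<bar> / \<bar>x\<bar>)) \<le> ereal \<delta>'"
    by (rule bound) (auto intro: filterlim_compose[OF filterlim_uminus_at_top_at_bot]
        filterlim_at_infinity_imp_norm_at_top[of "\<lambda>x::real. x" at_bot, simplified] 
        filterlim_mono[OF filterlim_ident at_bot_le_at_infinity order_refl])
qed

text \<open>
  The last assumption is what remains of \<open>m = |u|\<^sup>2\<close>, \<open>c = Re (cnj u y)\<close>, \<open>p = |y|\<^sup>2\<close> once \<open>u\<close> and \<open>y\<close>
  are forgotten: the value \<open>|s y + t u|\<^sup>2\<close> of the form is nonnegative.
\<close>

locale product_system =
  fixes m c p q :: "real \<Rightarrow> real"
  assumes dm: "(m has_real_derivative 2 * c x) (at x)"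
    and dc: "(c has_real_derivative p x - q x * m x) (at x)"
    and dp: "(p has_real_derivative - 2 * q x * c x) (at x)"
    and form_nonneg: "0 \<le> s\<^sup>2 * p x + 2 * s * t * c x + t\<^sup>2 * m x"
begin

lemma m_nonneg: "0 \<le> m x" and p_nonneg: "0 \<le> p x"
  using form_nonneg[of 0 x 1] form_nonneg[of 1 x 0] by simp_all

text \<open>
  Gronwall's inequality applies because \<open>(m + p)' = 2 (1 - q) c\<close> and \<open>2 |c| \<le> m + p\<close>.
\<close>

lemma crude_growth:
  assumes q: "\<And>x. \<bar>1 - q x\<bar> \<le> \<delta>"
  shows "m x + p x \<le> (m 0 + p 0) * exp (\<delta> * \<bar>x\<bar>)"
proof (rule gronwall_two_sided)
  fix x
  show "((\<lambda>x. m x + p x) has_real_derivative 2 * c x + - 2 * q x * c x) (at x)"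
    by (intro DERIV_add dm dp)
  have "\<bar>2 * c x\<bar> \<le> m x + p x"
    using form_nonneg[of 1 x 1] form_nonneg[of 1 x "-1"] by simp
  then have "\<bar>1 - q x\<bar> * \<bar>2 * c x\<bar> \<le> \<delta> * (m x + p x)"
    using q[of x] by (intro mult_mono) auto
  moreover have "2 * c x + - 2 * q x * c x = (1 - q x) * (2 * c x)" by (simp add: algebra_simps)
  ultimately show "\<bar>2 * c x + - 2 * q x * c x\<bar> \<le> \<delta> * (m x + p x)" by (simp only: abs_mult)
qed

text \<open>
  The function \<open>P\<close> is the defect of \<open>S\<close>. The two identities for \<open>W\<close> reduce the growth of solutions
  to the size of \<open>P'\<close>: the first makes \<open>W\<close> coercive as soon as \<open>S\<close> and \<open>1 + P\<close> stay away from
  zero, the second shows that \<open>W'\<close> involves \<open>m\<close> only, with coefficient \<open>P' / S\<close>.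
\<close>

lemma refined_growth:
  fixes e :: real and V V1 S S1 S2 S3 P P1 :: "real \<Rightarrow> real"
  assumes e: "0 < e" "e \<le> 1" and q: "\<And>x. e * q x = 1 - e * V x"
    and dV: "\<And>x. (V has_real_derivative V1 x) (at x)"
    and dS: "\<And>x. (S has_real_derivative S1 x) (at x)" "\<And>x. (S1 has_real_derivative S2 x) (at x)"
      "\<And>x. (S2 has_real_derivative S3 x) (at x)"
    and P: "\<And>x. (S x)\<^sup>2 * (1 - e * V x) + e * (S x * S2 x / 2 - (S1 x)\<^sup>2 / 4) - 1 = P x"
    and dP: "\<And>x. (P has_real_derivative P1 x) (at x)"
    and bS: "\<And>x. 1 / 2 \<le> S x" "\<And>x. S x \<le> 2" and bS1: "\<And>x. \<bar>S1 x\<bar> \<le> B"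
    and bP: "\<And>x. \<bar>P x\<bar> \<le> 1 / 2" and bP1: "\<And>x. \<bar>P1 x\<bar> \<le> \<delta>"
  shows "\<exists>M. \<forall>x. m x + e * p x \<le> M * exp (8 * \<delta> * \<bar>x\<bar>)"
proof -
  define W where "W = (\<lambda>x. e * S x * p x - e * S1 x * c x + (e * S2 x / 2 + (1 - e * V x) * S x) * m x)"
  define W' where "W' = (\<lambda>x. (e * S3 x / 2 + 2 * (1 - e * V x) * S1 x - e * V1 x * S x) * m x)"
  have dW: "(W has_real_derivative W' x) (at x)" for x
  proof -
    have "(W has_real_derivative
        e * (S1 x * p x - S x * (2 * q x * c x)) - e * (S2 x * c x + S1 x * (p x - q x * m x))
        + ((e * S3 x / 2 + (1 - e * V x) * S1 x - e * V1 x * S x) * m x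
        + (e * S2 x / 2 + (1 - e * V x) * S x) * (2 * c x))) (at x)"
      unfolding W_def
      by (auto intro!: derivative_eq_intros dm dc dp dV dS simp: algebra_simps)
    also have "e * (S1 x * p x - S x * (2 * q x * c x)) - e * (S2 x * c x + S1 x * (p x - q x * m x))
      = e * (S1 x * p x) - S x * (2 * (e * q x) * c x) - e * (S2 x * c x) - e * S1 x * p x + S1 x * (e * q x) * m x"
      by (simp add: algebra_simps)
    finally show ?thesis
      unfolding q by (rule DERIV_cong) (simp add: W'_def algebra_simps)
  qed
  have "S x * (e * S3 x / 2 + 2 * (1 - e * V x) * S1 x - e * V1 x * S x) = P1 x" for x
  proof -
    have "(P has_real_derivative
        2 * S x * S1 x * (1 - e * V x) - (S x)\<^sup>2 * (e * V1 x)
        + e * ((S1 x * S2 x + S x * S3 x) / 2 - 2 * S1 x * S2 x / 4)) (at x)"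
      unfolding P[symmetric, abs_def]
      by (auto intro!: derivative_eq_intros dV dS simp: algebra_simps)
    from DERIV_unique[OF this dP]
    show ?thesis by (simp add: power2_eq_square field_simps)
  qed
  then have SW': "S x * W' x = P1 x * m x" for x
    unfolding W'_def by (metis mult.assoc)
  have S_pos: "0 < S x" for x using bS(1)[of x] by linarith
  define X where "X = (\<lambda>x. (S x)\<^sup>2 * p x + 2 * S x * (- S1 x / 2) * c x + (- S1 x / 2)\<^sup>2 * m x)"
  have X_nonneg: "0 \<le> e * X x" for x
    unfolding X_def by (intro mult_nonneg_nonneg form_nonneg) (use e in simp)
  have SW: "S x * W x = e * X x + (1 + P x) * m x" for x
    unfolding W_def X_def P[symmetric] by (simp add: power2_eq_square field_simps)
  have SW_ge: "e * X x \<le> S x * W x" and m_SW: "m x \<le> 2 * (S x * W x)" for x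
  proof -
    have "1 / 2 * m x \<le> (1 + P x) * m x"
      using bP[of x] m_nonneg by (intro mult_right_mono) auto
    then show "e * X x \<le> S x * W x" "m x \<le> 2 * (S x * W x)"
      using m_nonneg[of x] X_nonneg[of x] SW[of x] by linarith+
  qed
  have W_nonneg: "0 \<le> W x" for x
  proof -
    have "0 \<le> S x * W x" using m_SW[of x] m_nonneg[of x] by linarith
    then show ?thesis using S_pos[of x] by (auto simp: zero_le_mult_iff)
  qed
  have SW_le: "S x * W x \<le> 2 * W x" for x using bS W_nonneg by (intro mult_right_mono) auto
  have m_W: "m x \<le> 4 * W x" for x using m_SW[of x] SW_le[of x] by linarith
  have \<delta>: "0 \<le> \<delta>" using bP1[of 0] by linarith
  have "\<bar>W' x\<bar> \<le> 8 * \<delta> * W x" for x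
  proof -
    have "1 / 2 * \<bar>W' x\<bar> \<le> S x * \<bar>W' x\<bar>" using bS by (intro mult_right_mono) auto
    also have "\<dots> = \<bar>P1 x\<bar> * m x" using SW'[of x] S_pos[of x] m_nonneg[of x] by (metis abs_mult abs_of_nonneg abs_of_pos)
    also have "\<dots> \<le> \<delta> * (4 * W x)" using bP1 m_W m_nonneg \<delta> by (intro mult_mono) auto
    finally show ?thesis by simp
  qed
  from gronwall_two_sided[OF dW this]
  have W_growth: "W x \<le> W 0 * exp (8 * \<delta> * \<bar>x\<bar>)" for x .
  have p_W: "e * p x \<le> (16 + 8 * B\<^sup>2) * W x" for x
  proof -
    \<comment> \<open>The elementary bound \<open>|S y|\<^sup>2 \<le> 2 |S y - S' u / 2|\<^sup>2 + 2 |S' u / 2|\<^sup>2\<close>.\<close>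
    have "1 / 4 * p x \<le> (S x)\<^sup>2 * p x"
      using power_mono[OF bS(1), of 2] p_nonneg by (intro mult_right_mono) (auto simp: power2_eq_square)
    also have "\<dots> \<le> 2 * X x + (S1 x)\<^sup>2 / 2 * m x"
      unfolding X_def using form_nonneg[of "S x" x "- S1 x"] by (simp add: power2_eq_square algebra_simps)
    finally have "e * (1 / 4 * p x) \<le> e * (2 * X x + (S1 x)\<^sup>2 / 2 * m x)"
      using e by (intro mult_left_mono) auto
    also have "\<dots> = 2 * (e * X x) + e * ((S1 x)\<^sup>2 / 2 * m x)"
      by (simp only: distrib_left mult.left_commute)
    also have "\<dots> \<le> 2 * (2 * W x) + B\<^sup>2 / 2 * (4 * W x)"
    proof (intro add_mono)
      show "2 * (e * X x) \<le> 2 * (2 * W x)"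
        using SW_ge[of x] SW_le[of x] by linarith
      have "(S1 x)\<^sup>2 \<le> B\<^sup>2" using power_mono[OF bS1[of x], of 2] by simp
      then have "(S1 x)\<^sup>2 / 2 * m x \<le> B\<^sup>2 / 2 * (4 * W x)"
        using m_W m_nonneg by (intro mult_mono) auto
      moreover have "e * ((S1 x)\<^sup>2 / 2 * m x) \<le> 1 * ((S1 x)\<^sup>2 / 2 * m x)"
        using e m_nonneg by (intro mult_right_mono mult_nonneg_nonneg) auto
      ultimately show "e * ((S1 x)\<^sup>2 / 2 * m x) \<le> B\<^sup>2 / 2 * (4 * W x)" by linarith
    qed
    finally show ?thesis by (simp add: algebra_simps)
  qed
  have "m x + e * p x \<le> (20 + 8 * B\<^sup>2) * W 0 * exp (8 * \<delta> * \<bar>x\<bar>)" for x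
  proof -
    have "m x + e * p x \<le> (20 + 8 * B\<^sup>2) * W x"
      using m_W[of x] p_W[of x] by (simp add: algebra_simps)
    also have "\<dots> \<le> (20 + 8 * B\<^sup>2) * (W 0 * exp (8 * \<delta> * \<bar>x\<bar>))"
      using W_growth by (intro mult_left_mono) auto
    finally show ?thesis by (simp add: mult.assoc)
  qed
  then show ?thesis by blast
qed

end

text \<open>
  The terms with \<open>\<alpha>\<close> rotate \<open>u\<close> and \<open>y\<close> by the same phase, so they do not contribute to the derivatives
  of the three quadratic quantities.
\<close>

lemma product_system_of_first_order_system:
  fixes u y :: "real \<Rightarrow> complex" and \<alpha> q :: "real \<Rightarrow> real"
  assumes du: "\<And>x. (u has_vector_derivative y x - \<i> * \<alpha> x * u x) (at x)"
    and dy: "\<And>x. (y has_vector_derivative - \<i> * \<alpha> x * y x - q x * u x) (at x)"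
  shows "product_system (\<lambda>x. (cmod (u x))\<^sup>2) (\<lambda>x. Re (cnj (u x) * y x)) (\<lambda>x. (cmod (y x))\<^sup>2) q"
proof
  fix x s t :: real
  note d = Re_Im_has_real_derivative[OF du[of x]] Re_Im_has_real_derivative[OF dy[of x]]
  show "((\<lambda>x. (cmod (u x))\<^sup>2) has_real_derivative 2 * Re (cnj (u x) * y x)) (at x)"
    unfolding cmod_power2
    by (rule DERIV_cong[OF DERIV_add[OF DERIV_power[OF d(1)] DERIV_power[OF d(2)]]])
      (simp add: algebra_simps)
  have "((\<lambda>x. Re (u x) * Re (y x) + Im (u x) * Im (y x)) has_real_derivative
      (cmod (y x))\<^sup>2 - q x * (cmod (u x))\<^sup>2) (at x)"
    unfolding cmod_power2
    by (rule DERIV_cong[OF DERIV_add[OF DERIV_mult[OF d(1) d(3)] DERIV_mult[OF d(2) d(4)]]])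
      (simp add: algebra_simps power2_eq_square)
  then show "((\<lambda>x. Re (cnj (u x) * y x)) has_real_derivative (cmod (y x))\<^sup>2 - q x * (cmod (u x))\<^sup>2) (at x)"
    by simp
  show "((\<lambda>x. (cmod (y x))\<^sup>2) has_real_derivative - 2 * q x * Re (cnj (u x) * y x)) (at x)"
    unfolding cmod_power2
    by (rule DERIV_cong[OF DERIV_add[OF DERIV_power[OF d(3)] DERIV_power[OF d(4)]]])
      (simp add: algebra_simps)
  have "0 \<le> (s * Re (y x) + t * Re (u x))\<^sup>2 + (s * Im (y x) + t * Im (u x))\<^sup>2" by simp
  then show "0 \<le> s\<^sup>2 * (cmod (y x))\<^sup>2 + 2 * s * t * Re (cnj (u x) * y x) + t\<^sup>2 * (cmod (u x))\<^sup>2"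
    unfolding cmod_power2 by (simp add: power2_eq_square algebra_simps)
qed

section \<open>Growth of solutions\<close>

lemma powi_bounds:
  fixes \<rho> :: real
  assumes "\<rho> > 1" "e = \<rho> powi (-2)"
  shows "0 < e" "e \<le> 1" "1 / e = \<rho>\<^sup>2" "e ^ N \<le> \<rho> powi (- int N)"
proof -
  have e: "e = 1 / \<rho>\<^sup>2" using assms by (simp add: power_int_minus divide_inverse)
  have "\<rho>\<^sup>2 \<ge> 1" using assms(1) by simp
  then show "0 < e" "e \<le> 1" "1 / e = \<rho>\<^sup>2" using assms(1) by (simp_all add: e)
  have "\<rho> ^ N \<le> (\<rho>\<^sup>2) ^ N" using assms(1) by (intro power_mono) (auto simp: power2_eq_square)
  then have "inverse ((\<rho>\<^sup>2) ^ N) \<le> inverse (\<rho> ^ N)"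
    using assms(1) by (intro le_imp_inverse_le) auto
  moreover have "e ^ N = inverse ((\<rho>\<^sup>2) ^ N)" by (simp only: e divide_inverse power_inverse mult_1)
  ultimately show "e ^ N \<le> \<rho> powi (- int N)" by (simp add: power_int_minus)
qed

text \<open>
  The constant \<open>C\<close> depends only on bounds for finitely many derivatives of \<open>r 0\<close> and \<open>s 0\<close>. Below the
  threshold \<open>e0\<close> the approximate solution \<open>S\<close> lies between \<open>1 / 2\<close> and \<open>3 / 2\<close> with defect at most
  \<open>1 / 2\<close>; above it, \<open>\<rho>\<^sup>2 < 1 / e0\<close>, and the crude rate is absorbed into \<open>C\<close>
  because \<open>\<rho> powi (- N)\<close> is bounded below by \<open>e0 ^ N\<close>.
\<close>

lemma uniform_growth:
  fixes r s :: "nat \<Rightarrow> real \<Rightarrow> real" and V :: "real \<Rightarrow> real"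
  assumes dr: "\<And>n x. (r n has_real_derivative r (Suc n) x) (at x)"
    and ds: "\<And>n x. (s n has_real_derivative s (Suc n) x) (at x)"
    and br: "\<And>n. \<exists>B. \<forall>x. \<bar>r n x\<bar> \<le> B" and bs: "\<And>n. \<exists>B. \<forall>x. \<bar>s n x\<bar> \<le> B"
    and V: "\<And>x. V x = s 0 x - (r 0 x)\<^sup>2 / 4"
  shows "\<exists>C. \<forall>\<rho>>1. \<forall>m c p. product_system m c p (\<lambda>x. \<rho>\<^sup>2 - V x) \<longrightarrow>
    (\<exists>\<delta> M. 0 \<le> \<delta> \<and> \<delta> \<le> C * \<rho> powi (- int N) \<and>
       (\<forall>x. m x + \<rho> powi (-2) * p x \<le> M * exp (\<delta> * \<bar>x\<bar>)))"
proof -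
  define \<G> where "\<G> = range r \<union> range s"
  define A where "A = param_algebra \<G>"
  have r_mem: "(\<lambda>e x. r n x) \<in> A" and s_mem: "(\<lambda>e x. s n x) \<in> A" for n
    unfolding A_def \<G>_def by (rule param_algebra.generator, simp)+
  have closed: "\<exists>f'\<in>A. \<forall>e x. (f e has_real_derivative f' e x) (at x)" if "f \<in> A" for f
  proof -
    have "\<exists>h\<in>A. \<forall>e x. (g has_real_derivative h e x) (at x)" if "g \<in> \<G>" for g
    proof -
      consider n where "g = r n" | n where "g = s n" using \<open>g \<in> \<G>\<close> unfolding \<G>_def by blast
      then show ?thesis
      proof cases
        case (1 n)
        show ?thesis by (rule bexI[OF _ r_mem[of "Suc n"]]) (simp add: 1 dr)
      next
        case (2 n)
        show ?thesis by (rule bexI[OF _ s_mem[of "Suc n"]]) (simp add: 2 ds)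
      qed
    qed
    then show ?thesis using param_algebra_deriv that unfolding A_def by blast
  qed
  have bounded: "\<exists>B. \<forall>e\<in>{0..1}. \<forall>x. \<bar>f e x\<bar> \<le> B" if "f \<in> A" for f
    using param_algebra_bounded[of \<G> f] that br bs unfolding A_def \<G>_def by blast
  have "(\<lambda>e x. s 0 x - (1 / 4) * r 0 x ^ 2) \<in> A"
    using r_mem s_mem unfolding A_def by (intro param_algebra_intros)
  then have V_mem: "(\<lambda>e x. V x) \<in> A" by (simp add: V[abs_def])
  obtain V1 :: "real \<Rightarrow> real \<Rightarrow> real" where V1: "\<And>e x. (V has_real_derivative V1 e x) (at x)"
    using closed[OF V_mem] by blast
  obtain BV where BV: "\<And>x. \<bar>V x\<bar> \<le> BV" using bounded[OF V_mem] by force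
  obtain S S1 S2 T R where mem: "S \<in> A" "S1 \<in> A" "S2 \<in> A" "T \<in> A" "R \<in> A"
    and dS: "\<And>e x. (S e has_real_derivative S1 e x) (at x)" "\<And>e x. (S1 e has_real_derivative S2 e x) (at x)"
    and ST: "\<And>e x. S e x = 1 + e * T e x"
    and R: "\<And>e x. (S e x)\<^sup>2 * (1 - e * V x) + e * (S e x * S2 e x / 2 - (S1 e x)\<^sup>2 / 4) - 1
      = e ^ Suc N * R e x"
    using approximate_product_solution[of \<G>, folded A_def, OF closed V_mem, of N] by metis
  obtain S3 where S3: "\<And>e x. (S2 e has_real_derivative S3 e x) (at x)" using closed mem by blast
  obtain R1 where R1: "R1 \<in> A" "\<And>e x. (R e has_real_derivative R1 e x) (at x)"
    using closed mem by blast
  obtain BS BT BR BR1 where B: "\<And>e x. e \<in> {0..1} \<Longrightarrow> \<bar>S1 e x\<bar> \<le> BS" "\<And>e x. e \<in> {0..1} \<Longrightarrow> \<bar>T e x\<bar> \<le> BT"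
    "\<And>e x. e \<in> {0..1} \<Longrightarrow> \<bar>R e x\<bar> \<le> BR" "\<And>e x. e \<in> {0..1} \<Longrightarrow> \<bar>R1 e x\<bar> \<le> BR1"
    using bounded mem R1(1) by metis
  have B0: "0 \<le> BV" "0 \<le> BT" "0 \<le> BR" "0 \<le> BR1" using BV[of 0] B[of 0 0] by auto
  define e0 where "e0 = 1 / (2 * (BT + BR + 1))"
  have e0: "e0 > 0" using B0 by (simp add: e0_def)
  define \<delta>0 where "\<delta>0 = 1 + 1 / e0 + BV"
  have \<delta>0: "\<delta>0 \<ge> 0" using e0 B0 by (simp add: \<delta>0_def)
  define C where "C = 8 * BR1 + \<delta>0 / e0 ^ N"
  have main: "\<exists>\<delta> M. 0 \<le> \<delta> \<and> \<delta> \<le> C * \<rho> powi (- int N) \<and>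
       (\<forall>x. m x + \<rho> powi (-2) * p x \<le> M * exp (\<delta> * \<bar>x\<bar>))"
    if \<rho>: "\<rho> > 1" and ps: "product_system m c p (\<lambda>x. \<rho>\<^sup>2 - V x)" for \<rho> m c p
  proof -
    interpret product_system m c p "\<lambda>x. \<rho>\<^sup>2 - V x" by (rule ps)
    define e where "e = \<rho> powi (-2)"
    note pb = powi_bounds[OF \<rho> e_def]
    have eN: "e ^ N \<le> \<rho> powi (- int N)" by (rule pb)
    have e_mem: "e \<in> {0..1}" using pb by simp
    have \<rho>e: "e * \<rho>\<^sup>2 = 1" using pb(1) pb(3)[symmetric] by simp
    show ?thesis
    proof (cases "e \<le> e0")
      case True
      have "e * (BT + BR + 1) \<le> e0 * (BT + BR + 1)" using True B0 by (intro mult_right_mono) auto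
      also have "\<dots> = 1 / 2" using B0 by (simp add: e0_def)
      finally have small: "e * BT \<le> 1 / 2" "e * BR \<le> 1 / 2"
        using B0 pb by (simp_all add: distrib_left) (smt (verit) mult_nonneg_nonneg)+
      have pow: "e ^ Suc N \<le> e" "e ^ Suc N \<le> e ^ N"
        using pb by (auto simp: power_le_one mult_left_le mult_left_le_one_le)
      have bT: "\<bar>e * T e x\<bar> \<le> 1 / 2" for x
      proof -
        have "\<bar>e * T e x\<bar> \<le> e * BT"
          unfolding abs_mult using pb B(2)[OF e_mem] by (intro mult_mono) auto
        then show ?thesis using small by linarith
      qed
      \<comment> \<open>Of the \<open>N + 1\<close> powers of \<open>e\<close>, one makes the defect at most \<open>1 / 2\<close>; the other \<open>N\<close> go into the rate.\<close>
      have bR: "\<bar>e ^ Suc N * R e x\<bar> \<le> 1 / 2" for x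
      proof -
        have "\<bar>e ^ Suc N * R e x\<bar> \<le> e * BR"
          unfolding abs_mult using pow pb B(3)[OF e_mem] by (intro mult_mono) auto
        then show ?thesis using small by linarith
      qed
      have bR1: "\<bar>e ^ Suc N * R1 e x\<bar> \<le> e ^ N * BR1" for x
        unfolding abs_mult using pow pb B(4)[OF e_mem] by (intro mult_mono) auto
      have "\<exists>M. \<forall>x. m x + e * p x \<le> M * exp (8 * (e ^ N * BR1) * \<bar>x\<bar>)"
      proof (rule refined_growth[where S = "S e" and ?S1.0 = "S1 e" and ?S2.0 = "S2 e" and ?S3.0 = "S3 e"
            and V = V and ?V1.0 = "V1 e" and P = "\<lambda>x. e ^ Suc N * R e x"
            and ?P1.0 = "\<lambda>x. e ^ Suc N * R1 e x" and B = BS])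
        show "e * (\<rho>\<^sup>2 - V x) = 1 - e * V x" for x using \<rho>e by (simp add: algebra_simps)
        show "1 / 2 \<le> S e x" "S e x \<le> 2" for x using bT[of x] unfolding ST by linarith+
        show "((\<lambda>x. e ^ Suc N * R e x) has_real_derivative e ^ Suc N * R1 e x) (at x)" for x
          by (intro DERIV_cmult R1)
      qed (fact pb V1 dS S3 R bR bR1 B(1)[OF e_mem])+
      moreover have "8 * (e ^ N * BR1) \<le> C * \<rho> powi (- int N)"
      proof -
        have "8 * (e ^ N * BR1) = 8 * BR1 * e ^ N" by simp
        also have "\<dots> \<le> C * \<rho> powi (- int N)"
          using eN pb B0 \<delta>0 e0 by (intro mult_mono) (auto simp: C_def)
        finally show ?thesis .
      qed
      moreover have "0 \<le> 8 * (e ^ N * BR1)" using pb B0 by simp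
      ultimately show ?thesis unfolding e_def[symmetric] by blast
    next
      case False
      have "\<rho>\<^sup>2 \<le> 1 / e0" using False e0 pb(3)[symmetric] by (simp add: frac_le)
      then have "\<bar>1 - (\<rho>\<^sup>2 - V x)\<bar> \<le> \<delta>0" for x
        using BV[of x] zero_le_power2[of \<rho>] unfolding \<delta>0_def by linarith
      from crude_growth[OF this]
      have growth: "m x + p x \<le> (m 0 + p 0) * exp (\<delta>0 * \<bar>x\<bar>)" for x .
      have "m x + e * p x \<le> (m 0 + p 0) * exp (\<delta>0 * \<bar>x\<bar>)" for x
        using growth[of x] mult_right_mono[OF pb(2) p_nonneg[of x]] by linarith
      moreover have "\<delta>0 \<le> C * \<rho> powi (- int N)"
      proof -
        have "e0 ^ N \<le> \<rho> powi (- int N)"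
          using power_mono[of e0 e N] False e0 eN by linarith
        then have "\<delta>0 / e0 ^ N * e0 ^ N \<le> C * \<rho> powi (- int N)"
          using B0 \<delta>0 e0 by (intro mult_mono) (auto simp: C_def)
        then show ?thesis using e0 by simp
      qed
      ultimately show ?thesis using \<delta>0 unfolding e_def[symmetric] by blast
    qed
  qed
  then show ?thesis by blast
qed

theorem corollary1p21:
  fixes Q :: "(real \<Rightarrow> complex) \<Rightarrow> real \<Rightarrow> complex" and N :: nat
  assumes "Q \<in> Diff1" and "formally_self_adjoint Q"
  shows "\<exists>C :: real. \<forall>\<rho> :: real. \<rho> > 1 \<longrightarrow>
           (\<forall>u :: real \<Rightarrow> complex. solution Q \<rho> u \<longrightarrow> (\<exists>x. u x \<noteq> 0) \<longrightarrow>
              Limsup at_top (\<lambda>x. ereal (ln \<bar>ED \<rho> u x\<bar> / \<bar>x\<bar>)) \<le> ereal (C * \<rho> powi (- int N)) \<and>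
              Limsup at_bot (\<lambda>x. ereal (ln \<bar>ED \<rho> u x\<bar> / \<bar>x\<bar>)) \<le> ereal (C * \<rho> powi (- int N)))"
proof -
  obtain a1 a0 where a1: "smooth_bounded a1" and a0: "smooth_bounded a0"
    and Q: "Q = (\<lambda>u x. a1 x * D_op u x + a0 x * u x)"
    using assms(1) unfolding Diff1_def by blast
  have sm: "smooth a1" "smooth a0" using a1 a0 by (auto simp: smooth_bounded_def)
  note coeffs = self_adjoint_coefficients[OF sm assms(2)[unfolded Q]]
  define r s where "r = (\<lambda>n x. Re ((vderiv ^^ n) a1 x))" and "s = (\<lambda>n x. Re ((vderiv ^^ n) a0 x))"
  define V where "V = (\<lambda>x. s 0 x - (r 0 x)\<^sup>2 / 4)"
  have dr: "(r n has_real_derivative r (Suc n) x) (at x)"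
    and ds: "(s n has_real_derivative s (Suc n) x) (at x)" for n x
    unfolding r_def s_def
    by (intro Re_Im_has_real_derivative smooth_has_vector_derivative sm)+
  have bdd: "\<exists>B. \<forall>x. \<bar>Re ((vderiv ^^ n) f x)\<bar> \<le> B" if f: "smooth_bounded f" for f n
  proof -
    obtain B where "\<forall>z\<in>range ((vderiv ^^ n) f). norm z \<le> B"
      using f unfolding smooth_bounded_def bounded_iff by blast
    then have "\<And>x. cmod ((vderiv ^^ n) f x) \<le> B" by blast
    then show ?thesis by (meson abs_Re_le_cmod order_trans)
  qed
  obtain C where C: "\<And>\<rho> m c p. \<rho> > 1 \<Longrightarrow> product_system m c p (\<lambda>x. \<rho>\<^sup>2 - V x) \<Longrightarrow>
      \<exists>\<delta> M. 0 \<le> \<delta> \<and> \<delta> \<le> C * \<rho> powi (- int N) \<and>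
       (\<forall>x. m x + \<rho> powi (-2) * p x \<le> M * exp (\<delta> * \<bar>x\<bar>))"
    using uniform_growth[of r s V N] dr ds bdd[OF a1] bdd[OF a0] unfolding V_def r_def s_def by blast
  obtain Br where Br: "\<And>x. \<bar>r 0 x\<bar> \<le> Br" using bdd[OF a1, of 0] unfolding r_def by auto
  have "Limsup at_top (\<lambda>x. ereal (ln \<bar>ED \<rho> u x\<bar> / \<bar>x\<bar>)) \<le> ereal (C * \<rho> powi (- int N)) \<and>
              Limsup at_bot (\<lambda>x. ereal (ln \<bar>ED \<rho> u x\<bar> / \<bar>x\<bar>)) \<le> ereal (C * \<rho> powi (- int N))"
    if \<rho>: "\<rho> > 1" and u: "solution Q \<rho> u" for \<rho> u
  proof -
    define v where "v = vderiv u"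
    define e where "e = \<rho> powi (-2)"
    note pb = powi_bounds[OF \<rho> e_def]
    have du: "(u has_vector_derivative v x) (at x)" for x
      using u unfolding solution_def v_def vderiv_def[of u] vector_derivative_works by blast
    have dv: "(v has_vector_derivative vderiv v x) (at x)" for x
      using u unfolding solution_def v_def[symmetric] vderiv_def[of v] vector_derivative_works by blast
    have a1r: "a1 x = of_real (r 0 x)" for x
      using coeffs(1)[of x] by (simp add: complex_eq_iff r_def)
    have a0r: "a0 x = Complex (s 0 x) (- r 1 x / 2)" for x
      using coeffs(2)[of x] by (simp add: complex_eq_iff r_def s_def)
    have eq: "vderiv v x = - \<i> * r 0 x * v x + Complex (s 0 x) (- r 1 x / 2) * u x - \<rho>\<^sup>2 * u x" for x
    proof -
      have "- vderiv v x + (a1 x * (- \<i> * v x) + a0 x * u x) = complex_of_real (\<rho>\<^sup>2) * u x"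
        using u unfolding solution_def Q D_op_def v_def by blast
      then show ?thesis unfolding a1r a0r by (simp add: algebra_simps)
    qed
    define y where "y = (\<lambda>x. v x + \<i> * of_real (r 0 x / 2) * u x)"
    have du': "(u has_vector_derivative y x - \<i> * of_real (r 0 x / 2) * u x) (at x)" for x
      using du[of x] by (simp add: y_def)
    have dy: "(y has_vector_derivative - \<i> * of_real (r 0 x / 2) * y x - of_real (\<rho>\<^sup>2 - V x) * u x) (at x)" for x
    proof -
      have "((\<lambda>x. complex_of_real (r 0 x / 2)) has_vector_derivative of_real (r 1 x / 2)) (at x)"
        using DERIV_cdivide[OF dr[of 0 x], of 2]
        by (simp add: has_real_derivative_iff_has_vector_derivative has_vector_derivative_of_real del: of_real_divide)
      then have "((\<lambda>x. \<i> * (of_real (r 0 x / 2) * u x)) has_vector_derivative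
          \<i> * (of_real (r 0 x / 2) * v x + of_real (r 1 x / 2) * u x)) (at x)"
        by (intro has_vector_derivative_mult_right has_vector_derivative_mult du)
      from has_vector_derivative_add[OF dv this]
      have "(y has_vector_derivative vderiv v x + \<i> * (of_real (r 0 x / 2) * v x + of_real (r 1 x / 2) * u x)) (at x)"
        by (simp add: y_def[abs_def] mult.assoc del: of_real_divide)
      moreover have "vderiv v x + \<i> * (of_real (r 0 x / 2) * v x + of_real (r 1 x / 2) * u x)
         = - \<i> * of_real (r 0 x / 2) * y x - of_real (\<rho>\<^sup>2 - V x) * u x"
        unfolding eq y_def V_def by (simp add: complex_eq_iff power2_eq_square field_simps)
      ultimately show ?thesis by simp
    qed
    obtain \<delta> M where \<delta>: "0 \<le> \<delta>" "\<delta> \<le> C * \<rho> powi (- int N)"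
      and growth: "\<And>x. (cmod (u x))\<^sup>2 + e * (cmod (y x))\<^sup>2 \<le> M * exp (\<delta> * \<bar>x\<bar>)"
      using C[OF \<rho> product_system_of_first_order_system[OF du' dy]] unfolding e_def by blast
    have ED: "ED \<rho> u x = (cmod (u x))\<^sup>2 + e * (cmod (v x))\<^sup>2" for x
      by (simp add: ED_def e_def v_def)
    have "ED \<rho> u x \<le> (2 + Br\<^sup>2) * M * exp (\<delta> * \<bar>x\<bar>)" for x
    proof -
      have "cmod (v x) \<le> cmod (y x) + cmod (\<i> * of_real (r 0 x / 2) * u x)"
        using norm_triangle_ineq4[of "y x" "\<i> * of_real (r 0 x / 2) * u x"] by (simp add: y_def)
      also have "\<dots> \<le> cmod (y x) + Br / 2 * cmod (u x)"
        using Br[of x] by (auto simp: norm_mult intro!: mult_right_mono)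
      finally have "(cmod (v x))\<^sup>2 \<le> (cmod (y x) + Br / 2 * cmod (u x))\<^sup>2" by (intro power_mono) auto
      also have "\<dots> \<le> 2 * (cmod (y x))\<^sup>2 + Br\<^sup>2 * (cmod (u x))\<^sup>2"
        using zero_le_power2[of "cmod (y x) - Br / 2 * cmod (u x)"]
          mult_nonneg_nonneg[OF zero_le_power2[of Br] zero_le_power2[of "cmod (u x)"]]
        by (simp add: power2_eq_square algebra_simps)
      finally have "e * (cmod (v x))\<^sup>2 \<le> e * (2 * (cmod (y x))\<^sup>2 + Br\<^sup>2 * (cmod (u x))\<^sup>2)"
        using pb by (intro mult_left_mono) auto
      moreover have "e * (Br\<^sup>2 * (cmod (u x))\<^sup>2) \<le> 1 * (Br\<^sup>2 * (cmod (u x))\<^sup>2)"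
        using pb by (intro mult_right_mono) auto
      moreover have "0 \<le> Br\<^sup>2 * (e * (cmod (y x))\<^sup>2)" using pb by simp
      ultimately have "ED \<rho> u x \<le> (2 + Br\<^sup>2) * ((cmod (u x))\<^sup>2 + e * (cmod (y x))\<^sup>2)"
        unfolding ED by (simp add: algebra_simps) (use zero_le_power2[of "cmod (u x)"] in linarith)
      also have "\<dots> \<le> (2 + Br\<^sup>2) * (M * exp (\<delta> * \<bar>x\<bar>))"
        using growth by (intro mult_left_mono) auto
      finally show ?thesis by (simp add: mult.assoc)
    qed
    moreover have "0 \<le> ED \<rho> u x" for x unfolding ED using pb by simp
    ultimately show ?thesis using Limsup_log_growth_le[of "ED \<rho> u"] \<delta> by blast
  qed
  then show ?thesis by blast
qed

end
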